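(* Let $n\ge0$ be an integer, let $x_0,\dots,x_n\in[0,1]$ be distinct nodes and let $f_0,\dots,f_n\in\mathbb{R}$ be given data. For $k=0,\dots,n$ let $$w_k(x)=\prod_{i=0}^{k-1}(x-x_i)\quad(w_0(x)=1),\qquad p_k(x)=\sum_{j=0}^{k}f[x_0,\dots,x_j]\,w_j(x),$$ where $f[x_0,\dots,x_j]$ are the divided differences of the data. Define $\{w_j^{(k)}\}_{j=0}^{k}$ and $\{c_j^{(k)}\}_{j=0}^{k}$ for $k=0,\dots,n$ by $w_0^{(0)}=1$, $c_0^{(0)}=f[x_0]$ and, for $k=1,\dots,n$ and $j=0,\dots,k$, $$w_j^{(k)}=\frac{j}{k}\,w_{j-1}^{(k-1)}(1-x_{k-1})-\frac{k-j}{k}\,w_j^{(k-1)}x_{k-1},$$ $$c_j^{(k)}=\frac{j}{k}\,c_{j-1}^{(k-1)}+\frac{k-j}{k}\,c_j^{(k-1)}+w_j^{(k)}f[x_0,\dots,x_k],$$ with the convention $c_{-1}^{(k-1)}=w_{-1}^{(k-1)}=0$ and $c_k^{(k-1)}=w_k^{(k-1)}=0$. Then, for every $k=0,\dots,n$, $\{w_j^{(k)}\}_{j=0}^{k}$ are the control points of $w_k$ and $\{c_j^{(k)}\}_{j=0}^{k}$ are the control points of $p_k$, i.e. $$w_k(x)=\sum_{j=0}^{k}w_j^{(k)}B_j^k(x),\qquad p_k(x)=\sum_{j=0}^{k}c_j^{(k)}B_j^k(x).$$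
   Context: For an integer $m\ge0$, the univariate Bernstein polynomials of degree $m$ on $[0,1]$ are $B_k^m(x)=\binom{m}{k}(1-x)^{m-k}x^k$, $k=0,\dots,m$; they form a basis of the polynomials of degree at most $m$. The control points of a polynomial $p$ of degree at most $m$ (in degree $m$) are the unique coefficients $\{c_k\}_{k=0}^m$ with $p=\sum_{k=0}^m c_kB_k^m$. The divided differences are defined recursively by $f[x_j]=f_j$ and $f[x_j,\dots,x_k]=\dfrac{f[x_{j+1},\dots,x_k]-f[x_j,\dots,x_{k-1}]}{x_k-x_j}$ for $k>j$. The polynomial $p_k$ is the Newton form of the polynomial of degree at most $k$ interpolating the data at $x_0,\dots,x_k$. *)

theory Defs
  imports "HOL-Analysis.Analysis"
begin

text \<open>The basis polynomial \<open>B\<^sub>k\<^sup>m\<close> is \<^const>\<open>Bernstein\<close>\<open> m k\<close>. Polynomials are represented by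
  their polynomial functions on the whole real line. Finite families such as
  \<open>x\<^sub>0, \<dots>, x\<^sub>n\<close> are functions on \<^typ>\<open>nat\<close> of which only the values up to the last index matter.\<close>

definition control_points :: "nat \<Rightarrow> (real \<Rightarrow> real) \<Rightarrow> (nat \<Rightarrow> real) \<Rightarrow> bool" where
  "control_points m p c \<longleftrightarrow>
     (\<forall>t. p t = (\<Sum>k\<le>m. c k * Bernstein m k t)) \<and>
     (\<forall>d. (\<forall>t. p t = (\<Sum>k\<le>m. d k * Bernstein m k t)) \<longrightarrow> (\<forall>k\<le>m. d k = c k))"

text \<open>\<open>divdiff x f j k\<close> is \<open>f[x\<^sub>j, \<dots>, x\<^sub>k]\<close>; it is meaningful for \<open>j \<le> k\<close> only.\<close>

function divdiff :: "(nat \<Rightarrow> real) \<Rightarrow> (nat \<Rightarrow> real) \<Rightarrow> nat \<Rightarrow> nat \<Rightarrow> real" where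
  "divdiff x f j k =
     (if k \<le> j then f j
      else (divdiff x f (j + 1) k - divdiff x f j (k - 1)) / (x k - x j))"
  by pat_completeness auto
termination by (relation "Wellfounded.measure (\<lambda>(x, f, j, k). k - j)") auto

declare divdiff.simps [simp del]

definition newton_basis :: "(nat \<Rightarrow> real) \<Rightarrow> nat \<Rightarrow> real \<Rightarrow> real" where
  "newton_basis x k t = (\<Prod>i<k. t - x i)"

definition newton_poly :: "(nat \<Rightarrow> real) \<Rightarrow> (nat \<Rightarrow> real) \<Rightarrow> nat \<Rightarrow> real \<Rightarrow> real" where
  "newton_poly x f k t = (\<Sum>j\<le>k. divdiff x f 0 j * newton_basis x j t)"

text \<open>\<open>w_coeff x k j\<close> and \<open>c_coeff x f k j\<close> are \<open>w\<^sub>j\<^sup>(\<^sup>k\<^sup>)\<close> and \<open>c\<^sub>j\<^sup>(\<^sup>k\<^sup>)\<close>. Both vanish for \<open>j > k\<close>,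
  and the case \<open>j = 0\<close> on the right-hand sides supplies the value \<open>0\<close> at the index \<open>-1\<close>.\<close>

primrec w_coeff :: "(nat \<Rightarrow> real) \<Rightarrow> nat \<Rightarrow> nat \<Rightarrow> real" where
  "w_coeff x 0 j = (if j = 0 then 1 else 0)"
| "w_coeff x (Suc k) j =
     (if j \<le> Suc k then
        real j / real (Suc k) * (if j = 0 then 0 else w_coeff x k (j - 1)) * (1 - x k)
        - (real (Suc k) - real j) / real (Suc k) * w_coeff x k j * x k
      else 0)"

primrec c_coeff :: "(nat \<Rightarrow> real) \<Rightarrow> (nat \<Rightarrow> real) \<Rightarrow> nat \<Rightarrow> nat \<Rightarrow> real" where
  "c_coeff x f 0 j = (if j = 0 then divdiff x f 0 0 else 0)"
| "c_coeff x f (Suc k) j =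
     (if j \<le> Suc k then
        real j / real (Suc k) * (if j = 0 then 0 else c_coeff x f k (j - 1))
        + (real (Suc k) - real j) / real (Suc k) * c_coeff x f k j
        + w_coeff x (Suc k) j * divdiff x f 0 (Suc k)
      else 0)"

end

theory Submission
  imports Defs
begin

text \<open>This is the absorption identity for binomial coefficients; the extra power of
  \<open>t\<close> in degree \<open>Suc k\<close> is the factor on the right.\<close>

lemma Bernstein_Suc_left:
  "real (Suc j) / real (Suc k) * Bernstein (Suc k) (Suc j) t = t * Bernstein k j t"
proof -
  have "real (Suc j) * real (Suc k choose Suc j) = real (Suc k) * real (k choose j)"
    by (metis Suc_times_binomial of_nat_mult)
  then have "real (Suc j) / real (Suc k) * real (Suc k choose Suc j) = real (k choose j)"
    by (simp add: field_simps)
  then show ?thesis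
    by (simp only: Bernstein_def mult.assoc[symmetric]) (simp add: mult_ac)
qed

text \<open>Mirror image of the previous identity: absorption on the complementary index, with
  \<open>Suc k - j = Suc (k - j)\<close> supplying the extra factor \<open>1 - t\<close>.\<close>

lemma Bernstein_Suc_right:
  assumes "j \<le> k"
  shows "(real (Suc k) - real j) / real (Suc k) * Bernstein (Suc k) j t = (1 - t) * Bernstein k j t"
proof -
  have "(Suc k - j) * (Suc k choose j) = Suc k * (k choose j)"
    by (metis binomial_absorb_comp diff_Suc_1)
  then have "(real (Suc k) - real j) * real (Suc k choose j) = real (Suc k) * real (k choose j)"
    using assms by (metis le_SucI of_nat_diff of_nat_mult)
  then have "(real (Suc k) - real j) / real (Suc k) * real (Suc k choose j) = real (k choose j)"
    by (simp add: field_simps)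
  then show ?thesis
    using assms by (simp only: Bernstein_def mult.assoc[symmetric]) (simp add: Suc_diff_le mult_ac)
qed

text \<open>Multiplication of a Bernstein form by the linear factor \<open>\<beta> (1 - t) + \<alpha> t\<close>. The cases
  \<open>\<alpha> = 1 - x\<^sub>k\<close>, \<open>\<beta> = - x\<^sub>k\<close> (the factor \<open>t - x\<^sub>k\<close>) and \<open>\<alpha> = \<beta> = 1\<close> (degree elevation)
  are the two recurrences.\<close>

lemma Bernstein_sum_times_linear:
  fixes a :: "nat \<Rightarrow> real"
  shows "(\<Sum>j\<le>Suc k. (real j / real (Suc k) * (if j = 0 then 0 else a (j - 1)) * \<alpha>
            + (real (Suc k) - real j) / real (Suc k) * a j * \<beta>) * Bernstein (Suc k) j t)
       = (\<alpha> * t + \<beta> * (1 - t)) * (\<Sum>j\<le>k. a j * Bernstein k j t)"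
proof -
  \<comment> \<open>The term at \<open>j = 0\<close> vanishes, so the index can be shifted down by
    one.\<close>
  have left: "(\<Sum>j\<le>Suc k. real j / real (Suc k) * (if j = 0 then 0 else a (j - 1)) * \<alpha> * Bernstein (Suc k) j t)
      = (\<Sum>j\<le>k. \<alpha> * a j * (real (Suc j) / real (Suc k) * Bernstein (Suc k) (Suc j) t))"
    by (simp only: sum.atMost_Suc_shift) (simp add: mult_ac)
  \<comment> \<open>Here the top term drops out: its weight is zero at \<open>j = Suc k\<close>,
    whatever the value of \<open>a (Suc k)\<close>.\<close>
  have right: "(\<Sum>j\<le>Suc k. (real (Suc k) - real j) / real (Suc k) * a j * \<beta> * Bernstein (Suc k) j t)
      = (\<Sum>j\<le>k. \<beta> * a j * ((real (Suc k) - real j) / real (Suc k) * Bernstein (Suc k) j t))"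
    by (simp add: mult_ac)
  have "(\<Sum>j\<le>k. \<alpha> * a j * (real (Suc j) / real (Suc k) * Bernstein (Suc k) (Suc j) t))
      = \<alpha> * t * (\<Sum>j\<le>k. a j * Bernstein k j t)"
    unfolding sum_distrib_left by (intro sum.cong refl) (subst Bernstein_Suc_left; simp)
  moreover have "(\<Sum>j\<le>k. \<beta> * a j * ((real (Suc k) - real j) / real (Suc k) * Bernstein (Suc k) j t))
      = \<beta> * (1 - t) * (\<Sum>j\<le>k. a j * Bernstein k j t)"
    unfolding sum_distrib_left by (intro sum.cong refl) (subst Bernstein_Suc_right; simp)
  ultimately show ?thesis
    by (simp only: distrib_right sum.distrib left right)
qed

text \<open>Substituting \<open>t = s / (1 + s)\<close> and clearing \<open>(1 + s)\<^sup>m\<close> turns the Bernstein form into the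
  ordinary polynomial \<open>\<Sum>k\<le>m. c\<^sub>k (m choose k) s\<^sup>k\<close>.\<close>

lemma Bernstein_sum_eq_0_imp:
  assumes zero: "\<And>t. (\<Sum>k\<le>m. c k * Bernstein m k t) = 0" and "k \<le> m"
  shows "c k = 0"
proof -
  let ?d = "\<lambda>k. c k * real (m choose k)"
  have root: "(\<Sum>k\<le>m. ?d k * s ^ k) = 0" if "s > 0" for s :: real
  proof -
    have "c k * Bernstein m k (s / (1 + s)) * (1 + s) ^ m = ?d k * s ^ k" if "k \<le> m" for k
    proof -
      have "1 - s / (1 + s) = 1 / (1 + s)" "(1 + s) ^ m = (1 + s) ^ k * (1 + s) ^ (m - k)"
        using \<open>s > 0\<close> that by (simp_all add: field_simps flip: power_add)
      then show ?thesis
        using \<open>s > 0\<close> by (simp add: Bernstein_def power_divide)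
    qed
    then have "(\<Sum>k\<le>m. ?d k * s ^ k) = (\<Sum>k\<le>m. c k * Bernstein m k (s / (1 + s))) * (1 + s) ^ m"
      unfolding sum_distrib_right by (intro sum.cong refl) (metis atMost_iff)
    then show ?thesis
      by (simp add: zero)
  qed
  \<comment> \<open>Every positive real is a root, whereas a polynomial with a nonzero coefficient
    has only finitely many.\<close>
  have "\<not> finite {s. (\<Sum>k\<le>m. ?d k * s ^ k) = 0}"
    using root infinite_Ioi[of "0::real"] by (auto dest: finite_subset[rotated, of _ "{0<..}"])
  then have "?d k = 0"
    using polyfun_finite_roots[of ?d m] \<open>k \<le> m\<close> by blast
  then show ?thesis
    using \<open>k \<le> m\<close> by (simp add: not_less)
qed

text \<open>Linear independence of the Bernstein polynomials makes uniqueness automatic, so only the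
  representations remain to be verified.\<close>

lemma control_points_iff:
  "control_points m p c \<longleftrightarrow> (\<forall>t. p t = (\<Sum>k\<le>m. c k * Bernstein m k t))"
proof -
  have "d k = c k"
    if "\<And>t. (\<Sum>k\<le>m. c k * Bernstein m k t) = (\<Sum>k\<le>m. d k * Bernstein m k t)" "k \<le> m" for d k
  proof -
    have "(\<Sum>k\<le>m. (d k - c k) * Bernstein m k t) = 0" for t
      using that(1)[of t] by (simp add: left_diff_distrib sum_subtractf)
    then have "d k - c k = 0"
      using \<open>k \<le> m\<close> by (rule Bernstein_sum_eq_0_imp)
    then show ?thesis
      by simp
  qed
  then show ?thesis
    unfolding control_points_def by metis
qed

lemma newton_basis_eq_Bernstein_sum:
  "newton_basis x k t = (\<Sum>j\<le>k. w_coeff x k j * Bernstein k j t)"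
proof (induction k)
  case 0
  show ?case
    by (simp add: newton_basis_def Bernstein_def)
next
  case (Suc k)
  have "(\<Sum>j\<le>Suc k. w_coeff x (Suc k) j * Bernstein (Suc k) j t)
      = (\<Sum>j\<le>Suc k. (real j / real (Suc k) * (if j = 0 then 0 else w_coeff x k (j - 1)) * (1 - x k)
          + (real (Suc k) - real j) / real (Suc k) * w_coeff x k j * (- x k)) * Bernstein (Suc k) j t)"
    by (intro sum.cong refl) simp
  also have "\<dots> = ((1 - x k) * t + (- x k) * (1 - t)) * newton_basis x k t"
    by (simp only: Bernstein_sum_times_linear Suc.IH)
  \<comment> \<open>The linear factor collapses to \<open>t - x k\<close>, the new factor of the
    product.\<close>
  also have "\<dots> = newton_basis x (Suc k) t"
    by (simp add: newton_basis_def algebra_simps)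
  finally show ?case ..
qed

text \<open>The first two terms of the recurrence elevate the degree of the previous Newton
  polynomial, since \<open>t + (1 - t) = 1\<close>; the third adds the new Newton term in its
  Bernstein form.\<close>

lemma newton_poly_eq_Bernstein_sum:
  "newton_poly x f k t = (\<Sum>j\<le>k. c_coeff x f k j * Bernstein k j t)"
proof (induction k)
  case 0
  show ?case
    by (simp add: newton_poly_def newton_basis_def Bernstein_def)
next
  case (Suc k)
  have "(\<Sum>j\<le>Suc k. c_coeff x f (Suc k) j * Bernstein (Suc k) j t)
      = (\<Sum>j\<le>Suc k. (real j / real (Suc k) * (if j = 0 then 0 else c_coeff x f k (j - 1)) * 1
          + (real (Suc k) - real j) / real (Suc k) * c_coeff x f k j * 1) * Bernstein (Suc k) j t
          + divdiff x f 0 (Suc k) * (w_coeff x (Suc k) j * Bernstein (Suc k) j t))"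
    by (intro sum.cong refl) (simp add: distrib_right del: w_coeff.simps of_nat_Suc)
  also have "\<dots> = (1 * t + 1 * (1 - t)) * newton_poly x f k t
      + divdiff x f 0 (Suc k) * newton_basis x (Suc k) t"
    by (simp only: sum.distrib Bernstein_sum_times_linear Suc.IH
        newton_basis_eq_Bernstein_sum[of x "Suc k"] sum_distrib_left[symmetric])
  also have "\<dots> = newton_poly x f (Suc k) t"
    by (simp add: newton_poly_def)
  finally show ?case ..
qed

theorem theorem2p2:
  fixes n :: nat and x f :: "nat \<Rightarrow> real"
  assumes nodes: "\<forall>i\<le>n. x i \<in> {0..1}"
    and distinct_nodes: "inj_on x {..n}"
  shows "\<forall>k\<le>n. control_points k (newton_basis x k) (w_coeff x k)
             \<and> control_points k (newton_poly x f k) (c_coeff x f k)"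
  by (simp add: control_points_iff newton_basis_eq_Bernstein_sum newton_poly_eq_Bernstein_sum)

end
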